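(* Consider reductions of the form $\hat u=m(\bar u)$, where $m(u)=\frac{a_1u+a_2}{a_3u+a_4}$ is a Möbius transformation whose coefficients $a_1,\dots,a_4$ are independent of the lattice variables $k$ and $l$. The admissible reductions of the lattice equations $Q1_\delta$, $Q2$, $Q3_\delta$ are the following. (1) For $Q1_\delta$: $m(u)=a\pm u$, for any $\delta$; and, when $\delta=0$, $m(u)=\frac{a_1u+a_2}{a_3u+a_4}$, provided $a_2a_3-a_1a_4\neq0$. (2) For $Q2$: the only admissible reduction is $m(u)=u$. (3) For $Q3_\delta$: $m(u)=\pm u$, for any $\delta$; $m(u)=\frac{a}{u}$, when $\delta=0$; and $m(u)=c\,u$, when $\delta=0$. Here $a$ and $c$ are constants.
   Context: For $u=u(k,l)$ on $\mathbb{Z}^2$ write $\bar u=u(k+1,l)$, $\hat u=u(k,l+1)$, $\hat{\bar u}=u(k+1,l+1)$, $\bar{\bar u}=u(k+2,l)$. The quad equations have the form $Q(u,\bar u,\hat u,\hat{\bar u})=0$, where $Q$ is an irreducible multi-affine polynomial in $u,\bar u,\hat u,\hat{\bar u}$, with lattice parameters $\alpha,\beta$ and a parameter $\delta$: $$Q3_\delta=\sinh(\alpha)(u\bar u+\hat u\hat{\bar u})-\sinh(\beta)(u\hat u+\bar u\hat{\bar u})-\sinh(\alpha-\beta)\big(\hat u\bar u+u\hat{\bar u}-\delta^2\sinh(\alpha)\sinh(\beta)\big),$$ $$Q2=\alpha(u-\hat u)(\bar u-\hat{\bar u})-\beta(u-\bar u)(\hat u-\hat{\bar u})+\alpha\beta(\alpha-\beta)(u+\hat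 u+\bar u+\hat{\bar u}-\alpha^2-\beta^2+\alpha\beta),$$ $$Q1_\delta=\alpha(u-\hat u)(\bar u-\hat{\bar u})-\beta(u-\bar u)(\hat u-\hat{\bar u})+\delta^2\alpha\beta(\alpha-\beta).$$ The reduction $\hat u=m(\bar u)$ is called admissible if the reduced equation is consistent on the lattice: the reduced equation on one quadrilateral, given by $Q(u,\bar u,m(\bar u),m(\bar{\bar u}))$, must be equal, up to a nonzero multiplicative factor, to the reduced equation on the diagonally adjacent quadrilateral, given by $Q(m(u),m(\bar u),m(m(\bar u)),m(m(\bar{\bar u})))$. *)

theory Defs
  imports Complex_Main "HOL-Computational_Algebra.Polynomial_Factorial"
begin

text \<open>
  Polynomials in \<open>u, u1, u2, u12\<close> (standing for \<open>u(k,l)\<close>, \<open>u(k+1,l)\<close>, \<open>u(k,l+1)\<close>,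
  \<open>u(k+1,l+1)\<close>) are iterated univariate polynomials over the complex numbers;
  \<open>u\<close> is the innermost indeterminate, \<open>u12\<close> the outermost one.
\<close>

type_synonym quad_poly = "complex poly poly poly poly"

definition const4 :: "complex \<Rightarrow> quad_poly" where
  "const4 c = [:[:[:[:c:]:]:]:]"

definition U :: quad_poly where "U = [:[:[:[:0, 1:]:]:]:]"
definition U1 :: quad_poly where "U1 = [:[:[:0, 1:]:]:]"
definition U2 :: quad_poly where "U2 = [:[:0, 1:]:]"
definition U12 :: quad_poly where "U12 = [:0, 1:]"

definition eval3 :: "complex poly poly poly \<Rightarrow> complex \<Rightarrow> complex \<Rightarrow> complex \<Rightarrow> complex" where
  "eval3 p x y z = poly (poly (poly p [:[:z:]:]) [:y:]) x"

definition eval4 :: "quad_poly \<Rightarrow> complex \<Rightarrow> complex \<Rightarrow> complex \<Rightarrow> complex \<Rightarrow> complex" where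
  "eval4 Q u u1 u2 u12 = eval3 (poly Q [:[:[:u12:]:]:]) u u1 u2"

definition Q3 :: "complex \<Rightarrow> complex \<Rightarrow> complex \<Rightarrow> quad_poly" where
  "Q3 \<alpha> \<beta> \<delta> =
     const4 (sinh \<alpha>) * (U * U1 + U2 * U12) - const4 (sinh \<beta>) * (U * U2 + U1 * U12)
     - const4 (sinh (\<alpha> - \<beta>)) * (U2 * U1 + U * U12 - const4 (\<delta>^2 * sinh \<alpha> * sinh \<beta>))"

definition Q2 :: "complex \<Rightarrow> complex \<Rightarrow> quad_poly" where
  "Q2 \<alpha> \<beta> =
     const4 \<alpha> * (U - U2) * (U1 - U12) - const4 \<beta> * (U - U1) * (U2 - U12)
     + const4 (\<alpha> * \<beta> * (\<alpha> - \<beta>)) * (U + U2 + U1 + U12 - const4 (\<alpha>^2 + \<beta>^2 - \<alpha> * \<beta>))"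

definition Q1 :: "complex \<Rightarrow> complex \<Rightarrow> complex \<Rightarrow> quad_poly" where
  "Q1 \<alpha> \<beta> \<delta> =
     const4 \<alpha> * (U - U2) * (U1 - U12) - const4 \<beta> * (U - U1) * (U2 - U12)
     + const4 (\<delta>^2 * \<alpha> * \<beta> * (\<alpha> - \<beta>))"

lemma eval4_Q3:
  "eval4 (Q3 \<alpha> \<beta> \<delta>) u u1 u2 u12 =
     sinh \<alpha> * (u * u1 + u2 * u12) - sinh \<beta> * (u * u2 + u1 * u12)
     - sinh (\<alpha> - \<beta>) * (u2 * u1 + u * u12 - \<delta>^2 * sinh \<alpha> * sinh \<beta>)"
  by (simp add: eval4_def eval3_def Q3_def const4_def U_def U1_def U2_def U12_def algebra_simps)

lemma eval4_Q2:
  "eval4 (Q2 \<alpha> \<beta>) u u1 u2 u12 =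
     \<alpha> * (u - u2) * (u1 - u12) - \<beta> * (u - u1) * (u2 - u12)
     + \<alpha> * \<beta> * (\<alpha> - \<beta>) * (u + u2 + u1 + u12 - \<alpha>^2 - \<beta>^2 + \<alpha> * \<beta>)"
  by (simp add: eval4_def eval3_def Q2_def const4_def U_def U1_def U2_def U12_def algebra_simps)

lemma eval4_Q1:
  "eval4 (Q1 \<alpha> \<beta> \<delta>) u u1 u2 u12 =
     \<alpha> * (u - u2) * (u1 - u12) - \<beta> * (u - u1) * (u2 - u12)
     + \<delta>^2 * \<alpha> * \<beta> * (\<alpha> - \<beta>)"
  by (simp add: eval4_def eval3_def Q1_def const4_def U_def U1_def U2_def U12_def algebra_simps)

text \<open>
  A Moebius transformation is used on the finite points that are not poles;
  outside \<open>moebius_dom\<close> the value of \<open>moebius\<close> is an artefact of \<open>x / 0 = 0\<close>.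
\<close>

definition moebius :: "complex \<Rightarrow> complex \<Rightarrow> complex \<Rightarrow> complex \<Rightarrow> complex \<Rightarrow> complex" where
  "moebius a1 a2 a3 a4 u = (a1 * u + a2) / (a3 * u + a4)"

definition moebius_dom :: "complex \<Rightarrow> complex \<Rightarrow> complex set" where
  "moebius_dom a3 a4 = {u. a3 * u + a4 \<noteq> 0}"

text \<open>
  With \<open>u, v, w\<close> standing for \<open>u(k,l)\<close>, \<open>u(k+1,l)\<close>, \<open>u(k+2,l)\<close>, the two reduced equations are
  compared as expressions in the independent values \<open>u, v, w\<close>, wherever all terms are defined.
  The multiplicative factor is the rational function \<open>p / q\<close>, required to have neither zeros nor
  poles there: an arbitrary nonzero rational factor would identify any two equations, while a
  constant factor would be too restrictive, because applying a Moebius transformation to the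
  arguments of \<open>Q\<close> produces denominators.
\<close>

definition admissible :: "quad_poly \<Rightarrow> (complex \<Rightarrow> complex) \<Rightarrow> complex set \<Rightarrow> bool" where
  "admissible Q m D \<longleftrightarrow>
     (\<exists>p q :: complex poly poly poly. \<forall>u v w.
        u \<in> D \<and> v \<in> D \<and> w \<in> D \<and> m v \<in> D \<and> m w \<in> D \<longrightarrow>
          eval3 p u v w \<noteq> 0 \<and> eval3 q u v w \<noteq> 0 \<and>
          eval4 Q u v (m v) (m w) =
            eval3 p u v w / eval3 q u v w * eval4 Q (m u) (m v) (m (m v)) (m (m w)))"

end

theory Submission imports Defs begin

text \<open>
  All three equations have the symmetric multi-affine shape \<open>quad A B C L K\<close>.  Admissibility makes
  every zero of the reduced equation a zero of the shifted one.  For fixed \<open>v\<close> both are bi-affine in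
  \<open>u\<close> and \<open>z = m w\<close>; eliminating \<open>z\<close> shows that their coefficient matrices are proportional.
  If \<open>m\<close> is affine, the choice \<open>v = 0\<close> already gives all constraints.  If \<open>m\<close> has a pole, the
  proportionality is a rational identity in \<open>v\<close>, and its leading behaviour at the pole yields
  \<open>(A - B - C) p + L = 0\<close> with \<open>p = m \<infinity>\<close>.  Here \<open>A - B - C\<close> vanishes for \<open>Q1\<close> and \<open>Q2\<close> but not for
  \<open>Q3\<close>, whereas \<open>L\<close> vanishes for \<open>Q1\<close> and \<open>Q3\<close> but not for \<open>Q2\<close>.  Irreducibility enters
  through \<open>A, B, C \<noteq> 0\<close>: otherwise the polynomial splits into two explicit factors.
\<close>

text \<open>The coefficients \<open>A, B, C\<close> are \<alpha>, \<beta>, \<alpha> - \<beta> for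
  \<open>Q1\<close> and \<open>Q2\<close>, and the hyperbolic sines of these numbers for
  \<open>Q3\<close>. The linear term is present only in \<open>Q2\<close>.\<close>

definition quad :: "complex \<Rightarrow> complex \<Rightarrow> complex \<Rightarrow> complex \<Rightarrow> complex \<Rightarrow>
    complex \<Rightarrow> complex \<Rightarrow> complex \<Rightarrow> complex \<Rightarrow> complex" where
  "quad A B C L K u u1 u2 u12 =
     A * (u * u1 + u2 * u12) - B * (u * u2 + u1 * u12) - C * (u1 * u2 + u * u12)
     + L * (u + u1 + u2 + u12) + K"

section \<open>Identities valid off a finite set\<close>

lemma eventually_cofinite_poly_neq_0:
  fixes P :: "'a :: idom poly"
  assumes "P \<noteq> 0"
  shows "\<forall>\<^sub>F v in cofinite. poly P v \<noteq> 0"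
  using poly_roots_finite[OF assms] by (simp add: eventually_cofinite)

lemma poly_eq_0_if_cofinite:
  fixes P :: "complex poly"
  assumes "\<forall>\<^sub>F v in cofinite. poly P v = 0"
  shows "P = 0"
proof (rule ccontr)
  assume "P \<noteq> 0"
  from eventually_cofinite_poly_neq_0[OF this] assms
  have "\<forall>\<^sub>F v::complex in cofinite. False"
    by eventually_elim simp
  then show False
    by (simp add: eventually_cofinite infinite_UNIV_char_0)
qed

text \<open>Finite sets are closed, so the two functions agree on a punctured neighbourhood of
  \<open>a\<close> and have the same limit there. This carries identities cleared of denominators to
  the excluded pole of \<open>m\<close>.\<close>

lemma continuous_cofinite_eq:
  fixes f g :: "complex \<Rightarrow> complex"
  assumes "\<forall>\<^sub>F v in cofinite. f v = g v" and "isCont f a" and "isCont g a"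
  shows "f a = g a"
proof -
  have "finite ({v. f v \<noteq> g v} - {a})"
    using assms(1) by (simp add: eventually_cofinite)
  then have "open (- ({v. f v \<noteq> g v} - {a}))"
    by (intro open_Compl finite_imp_closed)
  then have "\<forall>\<^sub>F v in at a. f v = g v"
    unfolding eventually_at_topological
    by (intro exI[of _ "- ({v. f v \<noteq> g v} - {a})"]) auto
  moreover have "(g \<longlongrightarrow> g a) (at a)" "(f \<longlongrightarrow> f a) (at a)"
    using assms(2,3) by (simp_all add: isCont_def)
  ultimately show ?thesis
    by (metis tendsto_cong tendsto_unique at_neq_bot)
qed

section \<open>Elimination between two bi-affine equations\<close>

text \<open>Solving the first equation for \<open>z\<close> and inserting the result into the second
  gives a quadratic in \<open>u\<close> with infinitely many zeros; the conclusions say that its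
  three coefficients vanish. The condition on \<open>S\<close> ensures that each forbidden value of
  \<open>z\<close> arises from at most one \<open>u\<close>.\<close>

lemma biaffine_elim:
  fixes a b c d a' b' c' d' :: complex
  assumes "finite S" and "a \<noteq> 0" and "\<And>e. e \<in> S \<Longrightarrow> a * e + b \<noteq> 0"
    and imp: "\<And>u z. \<lbrakk>u \<notin> S; z \<notin> S; a * u * z + b * u + c * z + d = 0\<rbrakk>
                \<Longrightarrow> a' * u * z + b' * u + c' * z + d' = 0"
  shows "a' * b = b' * a" and "c' * d = d' * c"
    and "a' * d + c' * b = b' * c + d' * a"
proof -
  define P where "P = [:d' * c - c' * d,
    b' * c + d' * a - a' * d - c' * b, b' * a - a' * b:]"
  \<comment> \<open>Besides \<open>S\<close>, this excludes the \<open>u\<close> for which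
    \<open>z\<close> cannot be solved for, and the preimages of \<open>S\<close> under the map from
    \<open>u\<close> to \<open>z\<close>.\<close>
  define bad where "bad = S \<union> {- c / a} \<union> (\<lambda>e. - (d + e * c) / (a * e + b)) ` S"
  have "poly P u = 0" if "u \<notin> bad" for u
  proof -
    have d: "a * u + c \<noteq> 0"
      using that \<open>a \<noteq> 0\<close> by (auto simp: bad_def field_simps add_eq_0_iff)
    define z where "z = - (b * u + d) / (a * u + c)"
    have zd: "z * (a * u + c) = - (b * u + d)"
      using d by (simp add: z_def)
    have "z \<notin> S"
    proof
      assume "z \<in> S"
      then have "a * z + b \<noteq> 0"
        by (rule assms(3))
      moreover have "(a * z + b) * u = - (d + z * c)"
        using zd by (simp add: algebra_simps add_eq_0_iff)
      ultimately have "u = - (d + z * c) / (a * z + b)"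
        by (simp add: field_simps)
      with \<open>z \<in> S\<close> that show False
        by (auto simp: bad_def)
    qed
    moreover have "u \<notin> S"
      using that by (simp add: bad_def)
    moreover have "a * u * z + b * u + c * z + d = 0"
      using zd by (simp add: algebra_simps)
    ultimately have "a' * u * z + b' * u + c' * z + d' = 0"
      using imp by blast
    \<comment> \<open>After multiplication by \<open>a * u + c\<close>, the variable
      \<open>z\<close> occurs only in a product that \<open>zd\<close> evaluates.\<close>
    then have "(a' * u + c') * (z * (a * u + c)) + (b' * u + d') * (a * u + c) = 0"
      by algebra
    then show ?thesis
      unfolding zd by (simp add: P_def algebra_simps)
  qed
  then have "{u. poly P u \<noteq> 0} \<subseteq> bad"
    by blast
  moreover have "finite bad"
    using \<open>finite S\<close> by (simp add: bad_def)
  ultimately have "\<forall>\<^sub>F u in cofinite. poly P u = 0"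
    unfolding eventually_cofinite by (rule finite_subset)
  then have "P = 0"
    by (rule poly_eq_0_if_cofinite)
  then show "a' * b = b' * a" and "c' * d = d' * c"
    and "a' * d + c' * b = b' * c + d' * a"
    by (simp_all add: P_def algebra_simps)
qed

section \<open>Constraints when \<open>m\<close> is affine\<close>

text \<open>Here \<open>z\<close> stands for \<open>m w\<close>, which is arbitrary because an
  affine \<open>m\<close> with nonzero slope is onto. At \<open>v = 0\<close> the elimination
  compares the coefficients of \<open>u * z\<close>, \<open>u\<close>, \<open>z\<close> and 1;
  \<open>t12\<close>, \<open>t21\<close>, \<open>t22\<close> are the last three for the shifted
  equation, and \<open>y\<close> is \<open>m (m 0)\<close>.\<close>

lemma affine_reduction:
  assumes "C \<noteq> 0" and "p \<noteq> 0"
    and imp: "\<And>u v z. quad A B C L K u v (p * v + q) z = 0 \<Longrightarrow>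
      quad A B C L K (p * u + q) (p * v + q) (p * (p * v + q) + q) (p * z + q) = 0"
  shows "(A - B - C) * q = (p - 1) * L" and "2 * (p + 1) * L * q = (p\<^sup>2 - 1) * K"
proof -
  define y where "y = p * q + q"
  define t12 where "t12 = - C * p * q + p * (A * q - B * y + L)"
  define t21 where "t21 = - C * p * q + p * (A * y - B * q + L)"
  define t22 where "t22 = - C * q\<^sup>2 + q * ((A - B) * (q + y) + 2 * L) - C * q * y + L * (q + y) + K"
  have "(- C * p\<^sup>2) * u * z + t12 * u + t21 * z + t22 = 0"
    if "(- C) * u * z + (L - B * q) * u + (A * q + L) * z + (L * q + K) = 0" for u z
    using imp[of u 0 z] that
    unfolding quad_def t12_def t21_def t22_def y_def
    by (simp add: algebra_simps power2_eq_square)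
  note elim = biaffine_elim[where S = "{}" and a = "- C" and b = "L - B * q" and c = "A * q + L"
      and d = "L * q + K" and a' = "- C * p\<^sup>2" and b' = t12 and c' = t21 and d' = t22,
      OF _ _ _ this]
  from elim(1,3) \<open>C \<noteq> 0\<close>
  have "(- C * p\<^sup>2) * (L - B * q) = t12 * (- C)"
    and 2: "(- C * p\<^sup>2) * (L * q + K) + t21 * (L - B * q) = t12 * (A * q + L) + t22 * (- C)"
    by auto
  then have "C * (p\<^sup>2 * (L - B * q) - t12) = 0"
    by (simp add: algebra_simps)
  \<comment> \<open>The coefficients \<open>- C\<close> and \<open>- C * p\<^sup>2\<close> of
    \<open>u * z\<close> fix the proportionality factor as \<open>p\<^sup>2\<close>; the remaining
    coefficients must then agree up to this same factor.\<close>
  with \<open>C \<noteq> 0\<close> have 3: "p\<^sup>2 * (L - B * q) = t12"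
    by simp
  then have "p * ((A - B - C) * q - (p - 1) * L) = 0"
    unfolding t12_def y_def by (simp add: algebra_simps power2_eq_square)
  with \<open>p \<noteq> 0\<close> show E: "(A - B - C) * q = (p - 1) * L"
    by simp
  have "t21 - p\<^sup>2 * (A * q + L) = p * ((A - B - C) * q - (p - 1) * L)"
    unfolding t21_def y_def by (simp add: algebra_simps power2_eq_square)
  with E have 4: "t21 = p\<^sup>2 * (A * q + L)"
    by simp
  have "C * (t22 - p\<^sup>2 * (L * q + K)) = 0"
    using 2 unfolding 3[symmetric] 4 by (simp add: algebra_simps)
  with \<open>C \<noteq> 0\<close> have 5: "t22 = p\<^sup>2 * (L * q + K)"
    by simp
  \<comment> \<open>Splitting off a multiple of the first constraint leaves exactly the second
    one.\<close>
  have "t22 - p\<^sup>2 * (L * q + K) =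
      (p + 2) * q * ((A - B - C) * q - (p - 1) * L) + (2 * (p + 1) * L * q - (p\<^sup>2 - 1) * K)"
    unfolding t22_def y_def by (simp add: algebra_simps power2_eq_square)
  with E 5 show "2 * (p + 1) * L * q = (p\<^sup>2 - 1) * K"
    by simp
qed

section \<open>Constraints when \<open>m\<close> has a pole\<close>

text \<open>The denominator is normalised to be monic, so \<open>- s\<close> is the pole and
  \<open>p\<close> is the value at infinity. Again \<open>z\<close> stands for \<open>m w\<close>:
  it avoids \<open>p\<close>, which is not a value of \<open>m\<close> at a finite point of its
  domain, and it avoids \<open>- s\<close> so that \<open>m z\<close> is defined.\<close>

locale fractional_reduction =
  fixes A B C L K p q s :: complex and m :: "complex \<Rightarrow> complex"
  assumes A: "A \<noteq> 0" and B: "B \<noteq> 0" and C: "C \<noteq> 0" and det: "p * s - q \<noteq> 0"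
    and m: "\<And>u. m u = (p * u + q) / (u + s)"
    and imp: "\<And>u v z. \<lbrakk>u \<noteq> - s; v \<noteq> - s; m v \<noteq> - s; z \<noteq> - s; z \<noteq> p;
        quad A B C L K u v (m v) z = 0\<rbrakk> \<Longrightarrow>
      quad A B C L K (m u) (m v) (m (m v)) (m z) = 0"
begin

text \<open>
  The entries \<open>- C, n12, n21, n22\<close> are the coefficients of \<open>uz, u, z, 1\<close> in the reduced equation, and
  \<open>t11, \<dots>, t22\<close> those of the shifted one times \<open>(u + s) (z + s)\<close>.
\<close>

lemma minors:
  shows "\<forall>\<^sub>F v in cofinite. v + s \<noteq> 0 \<and> m v + s \<noteq> 0 \<and>
    (let x = m v; y = m x;
       n12 = A * v - B * x + L; n21 = A * x - B * v + L; n22 = - C * v * x + L * (v + x) + K;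
       k12 = A * x - B * y + L; k21 = A * y - B * x + L; k22 = - C * x * y + L * (x + y) + K;
       t11 = - C * p\<^sup>2 + p * (k12 + k21) + k22;
       t12 = - C * p * q + k12 * p * s + k21 * q + k22 * s;
       t21 = - C * p * q + k12 * q + k21 * p * s + k22 * s;
       t22 = - C * q\<^sup>2 + (k12 + k21) * q * s + k22 * s\<^sup>2
     in t11 * n12 = t12 * (- C) \<and> t21 * n22 = t22 * n21)"
proof -
  have "[:s, 1:] \<noteq> 0" by simp
  from eventually_cofinite_poly_neq_0[OF this]
  have 1: "\<forall>\<^sub>F v in cofinite. v + s \<noteq> 0"
    by (simp add: add.commute)
  \<comment> \<open>This is the numerator of \<open>m v + s\<close>. If both coefficients vanished,
    then \<open>p = - s\<close> and \<open>q = - s\<^sup>2\<close>, which would make the determinant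
    zero.\<close>
  have "[:q + s\<^sup>2, p + s:] \<noteq> 0"
    using det by (auto simp: add_eq_0_iff power2_eq_square)
  from eventually_cofinite_poly_neq_0[OF this]
  have 2: "\<forall>\<^sub>F v in cofinite. (p * v + q) + s * (v + s) \<noteq> 0"
    by (rule eventually_mono) (simp add: algebra_simps power2_eq_square)
  \<comment> \<open>For \<open>e = p\<close> and \<open>e = - s\<close> this is the side condition
    of \<open>biaffine_elim\<close> multiplied by \<open>v + s\<close>; the leading coefficient
    \<open>A\<close> keeps the polynomial nonzero.\<close>
  have 3: "\<forall>\<^sub>F v in cofinite. (A * v + L - C * e) * (v + s) - B * (p * v + q) \<noteq> 0" for e
  proof -
    have "[:(L - C * e) * s - B * q, A * s + L - C * e - B * p, A:] \<noteq> 0"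
      using A by simp
    from eventually_cofinite_poly_neq_0[OF this] show ?thesis
      by (rule eventually_mono) (simp add: algebra_simps)
  qed
  from 1 2 3[of p] 3[of "-s"] show ?thesis
  proof eventually_elim
    case (elim v)
    define x y where "x = m v" and "y = m x"
    define n12 n21 n22 where "n12 = A * v - B * x + L" and "n21 = A * x - B * v + L"
      and "n22 = - C * v * x + L * (v + x) + K"
    define k12 k21 k22 where "k12 = A * x - B * y + L" and "k21 = A * y - B * x + L"
      and "k22 = - C * x * y + L * (x + y) + K"
    define t11 t12 t21 t22 where "t11 = - C * p\<^sup>2 + p * (k12 + k21) + k22"
      and "t12 = - C * p * q + k12 * p * s + k21 * q + k22 * s"
      and "t21 = - C * p * q + k12 * q + k21 * p * s + k22 * s"
      and "t22 = - C * q\<^sup>2 + (k12 + k21) * q * s + k22 * s\<^sup>2"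
    have xs: "x * (v + s) = p * v + q"
      using elim(1) by (simp add: x_def m)
    have "(x + s) * (v + s) \<noteq> 0"
      using elim(2) xs by (simp add: algebra_simps)
    then have x: "x + s \<noteq> 0" by simp
    have nz: "(- C) * e + n12 \<noteq> 0" if "e \<in> {p, - s}" for e
    proof -
      have "((- C) * e + n12) * (v + s) = (A * v + L - C * e) * (v + s) - B * (x * (v + s))"
        by (simp add: n12_def algebra_simps)
      also have "\<dots> \<noteq> 0"
        unfolding xs using elim(3,4) that by auto
      finally show ?thesis by auto
    qed
    have imp': "t11 * u * z + t12 * u + t21 * z + t22 = 0"
      if "u \<notin> {p, - s}" "z \<notin> {p, - s}" "(- C) * u * z + n12 * u + n21 * z + n22 = 0" for u z
    proof -
      have us: "u + s \<noteq> 0" and zs: "z + s \<noteq> 0"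
        using that by (auto simp: add_eq_0_iff2)
      have "quad A B C L K u v x z = 0"
        using that(3) by (simp add: quad_def n12_def n21_def n22_def algebra_simps)
      then have "quad A B C L K (m u) x y (m z) = 0"
        using imp[of u v z] that(1,2) elim(1) x by (simp add: x_def y_def eq_neg_iff_add_eq_0)
      then have "0 = (u + s) * (z + s) * (- C * m u * m z + k12 * m u + k21 * m z + k22)"
        by (simp add: quad_def k12_def k21_def k22_def algebra_simps)
      also have "\<dots> = - C * (m u * (u + s)) * (m z * (z + s)) + k12 * (m u * (u + s)) * (z + s)
          + k21 * (u + s) * (m z * (z + s)) + k22 * (u + s) * (z + s)"
        by (simp add: algebra_simps)
      also have "m u * (u + s) = p * u + q"
        using us by (simp add: m)
      also have "m z * (z + s) = p * z + q"
        using zs by (simp add: m)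
      finally show ?thesis
        by (simp add: t11_def t12_def t21_def t22_def algebra_simps power2_eq_square)
    qed
    have "finite {p, - s}" and "- C \<noteq> 0"
      using C by simp_all
    note minors = biaffine_elim(1,2)[where S = "{p, - s}" and a = "- C" and b = n12 and c = n21
        and d = n22 and a' = t11 and b' = t12 and c' = t21 and d' = t22, OF this nz imp']
    have "m v + s \<noteq> 0"
      using x by (simp add: x_def)
    show ?case
      unfolding Let_def
      by (intro conjI; (rule minors[unfolded t11_def t12_def t21_def t22_def n12_def n21_def n22_def k12_def k21_def k22_def y_def x_def] | fact))
  qed
qed


text \<open>The first two constraints come from evaluating one of the two minors at the pole of
  \<open>m\<close>. In the last two, the first minor collapses to a polynomial identity in
  \<open>v\<close> whose leading coefficient is \<open>K * A\<close>.\<close>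

lemma constraints:
  shows "(A - B - C) * p + L = 0"
    and "\<lbrakk>p = 0; L = 0\<rbrakk> \<Longrightarrow> (A - B - C) * s = 0"
    and "\<lbrakk>A - B - C = 0; L = 0\<rbrakk> \<Longrightarrow> K = 0"
    and "\<lbrakk>p = 0; s = 0; L = 0\<rbrakk> \<Longrightarrow> K = 0"
proof -
  \<comment> \<open>Homogeneous coordinates \<open>m v = X v / W v\<close> and \<open>m (m v) = Y1 v / Y2 v\<close>: the identities cleared
    of denominators can be evaluated at the pole \<open>v = - s\<close>.\<close>
  define X W Y1 Y2 where "X v = p * v + q" and "W v = v + s"
    and "Y1 v = p * X v + q * W v" and "Y2 v = X v + s * W v" for v
  have xW: "m v * W v = X v" if "v + s \<noteq> 0" for v
    using that by (simp add: m W_def X_def)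
  have Y2: "Y2 v = (m v + s) * W v" if "v + s \<noteq> 0" for v
    using xW[OF that] by (simp add: Y2_def algebra_simps)
  have yY2: "m (m v) * Y2 v = Y1 v" if "v + s \<noteq> 0" "m v + s \<noteq> 0" for v
  proof -
    have "m (m v) * (m v + s) = p * m v + q"
      using that(2) by (subst (1) m) simp
    moreover have "m (m v) * Y2 v = (m (m v) * (m v + s)) * W v"
      by (simp add: Y2[OF that(1)])
    ultimately have "m (m v) * Y2 v = p * (m v * W v) + q * W v"
      by (simp add: distrib_right)
    then show ?thesis
      by (simp add: xW[OF that(1)] Y1_def)
  qed
  have X0: "X (- s) \<noteq> 0" and W0: "W (- s) = 0" and Y0: "Y1 (- s) = p * X (- s)" "Y2 (- s) = X (- s)"
    using det by (auto simp: X_def W_def Y1_def Y2_def)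
  note cont = X_def W_def Y1_def Y2_def

  show 1: "(A - B - C) * p + L = 0"
  proof -
    define k where "k v = - C * X v * Y1 v + L * (X v * Y2 v + Y1 v * W v) + K * W v * Y2 v" for v
    \<comment> \<open>\<open>f\<close> and \<open>g\<close> are the two sides of the first minor
      multiplied by \<open>(W v)\<^sup>2 * Y2 v\<close>, which makes them polynomials;
      \<open>k\<close> is \<open>k22\<close> multiplied by \<open>W v * Y2 v\<close>.\<close>
    define f where "f v = (- C * p\<^sup>2 * W v * Y2 v
      + p * ((A - B) * (X v * Y2 v + Y1 v * W v) + 2 * L * W v * Y2 v) + k v)
      * ((A * v + L) * W v - B * X v)" for v
    define g where "g v = (- C * p * q * W v * Y2 v
      + (A * X v * Y2 v - B * Y1 v * W v + L * W v * Y2 v) * p * s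
      + (A * Y1 v * W v - B * X v * Y2 v + L * W v * Y2 v) * q + k v * s) * (- C * W v)" for v
    have "\<forall>\<^sub>F v in cofinite. f v = g v"
      using minors
    proof eventually_elim
      case (elim v)
      then have v: "v + s \<noteq> 0" "m v + s \<noteq> 0" by simp_all
      define x y w w' where "x = m v" and "y = m (m v)" and "w = W v" and "w' = Y2 v"
      have XY: "X v = x * w" "Y1 v = y * w'"
        using xW yY2 v by (simp_all add: x_def y_def w_def w'_def)
      define n12 where "n12 = A * v - B * x + L"
      define k12 k21 k22 where "k12 = A * x - B * y + L" and "k21 = A * y - B * x + L"
        and "k22 = - C * x * y + L * (x + y) + K"
      define t11 t12 where "t11 = - C * p\<^sup>2 + p * (k12 + k21) + k22"
        and "t12 = - C * p * q + k12 * p * s + k21 * q + k22 * s"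
      have eq: "t11 * n12 = t12 * (- C)"
        using elim unfolding Let_def t11_def t12_def n12_def k12_def k21_def k22_def x_def y_def
        by blast
      have "f v = (w * w' * t11) * (w * n12)"
        unfolding f_def k_def XY w_def[symmetric] w'_def[symmetric]
          t11_def n12_def k12_def k21_def k22_def
        by (simp add: algebra_simps)
      also have "\<dots> = w * w' * w * (t11 * n12)"
        by (simp add: algebra_simps)
      also have "\<dots> = (w * w' * t12) * (- C * w)"
        by (simp add: eq)
      also have "\<dots> = g v"
        unfolding g_def k_def XY w_def[symmetric] w'_def[symmetric]
          t12_def k12_def k21_def k22_def
        by (simp add: algebra_simps)
      finally show ?case .
    qed
    then have "f (- s) = g (- s)"
      by (rule continuous_cofinite_eq)
        (unfold f_def g_def k_def cont; intro continuous_intros)+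
    \<comment> \<open>At the pole \<open>W\<close> vanishes, so \<open>g\<close> disappears and only
      the terms of \<open>f\<close> free of \<open>W\<close> survive.\<close>
    then have "((A - B - C) * p + L) * B * X (- s) ^ 3 = 0"
      unfolding f_def g_def k_def W0 Y0 by (simp add: algebra_simps power3_eq_cube)
    with X0 B show ?thesis
      by simp
  qed

  show "(A - B - C) * s = 0" if pL: "p = 0" "L = 0"
  proof -
    define k where "k v = - C * X v * Y1 v + K * W v * Y2 v" for v
    \<comment> \<open>The second minor is cleared in the same way. At the pole, \<open>f\<close>
      contributes \<open>A * C * s * q ^ 4\<close> and \<open>g\<close> contributes
      \<open>A * (A - B) * s * q ^ 4\<close>.\<close>
    define f where "f v = ((A * X v * Y2 v - B * Y1 v * W v) * q + k v * s)
      * (- C * v * X v + K * W v)" for v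
    define g where "g v = (- C * q\<^sup>2 * W v * Y2 v
      + (A - B) * (X v * Y2 v + Y1 v * W v) * q * s + k v * s\<^sup>2) * (A * X v - B * v * W v)" for v
    have "\<forall>\<^sub>F v in cofinite. f v = g v"
      using minors
    proof eventually_elim
      case (elim v)
      then have v: "v + s \<noteq> 0" "m v + s \<noteq> 0" by simp_all
      define x y w w' where "x = m v" and "y = m (m v)" and "w = W v" and "w' = Y2 v"
      have XY: "X v = x * w" "Y1 v = y * w'"
        using xW yY2 v by (simp_all add: x_def y_def w_def w'_def)
      define n21 n22 where "n21 = A * x - B * v + L" and "n22 = - C * v * x + L * (v + x) + K"
      define k12 k21 k22 where "k12 = A * x - B * y + L" and "k21 = A * y - B * x + L"
        and "k22 = - C * x * y + L * (x + y) + K"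
      define t21 t22 where "t21 = - C * p * q + k12 * q + k21 * p * s + k22 * s"
        and "t22 = - C * q\<^sup>2 + (k12 + k21) * q * s + k22 * s\<^sup>2"
      have eq: "t21 * n22 = t22 * n21"
        using elim unfolding Let_def t21_def t22_def n21_def n22_def k12_def k21_def k22_def
          x_def y_def
        by blast
      have "f v = (w * w' * t21) * (w * n22)"
        unfolding f_def k_def XY w_def[symmetric] w'_def[symmetric]
          t21_def n22_def k12_def k21_def k22_def pL
        by (simp add: algebra_simps)
      also have "\<dots> = w * w' * w * (t21 * n22)"
        by (simp add: algebra_simps)
      also have "\<dots> = (w * w' * t22) * (w * n21)"
        by (simp add: eq)
      also have "\<dots> = g v"
        unfolding g_def k_def XY w_def[symmetric] w'_def[symmetric]
          t22_def n21_def k12_def k21_def k22_def pL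
        by (simp add: algebra_simps)
      finally show ?case .
    qed
    then have "f (- s) = g (- s)"
      by (rule continuous_cofinite_eq)
        (unfold f_def g_def k_def cont; intro continuous_intros)+
    moreover have "X (- s) = q"
      using pL by (simp add: X_def)
    ultimately have "((A - B - C) * s) * A * q ^ 4 = 0"
      unfolding f_def g_def k_def W0 Y0 pL by (simp add: algebra_simps power4_eq_xxxx)
    moreover have "q \<noteq> 0"
      using det pL by simp
    ultimately show ?thesis
      using A by simp
  qed

  show "K = 0" if E: "A - B - C = 0" "L = 0"
  proof -
    define P where "P = [:K * (C * s * s - B * q), K * (A * s + C * s - B * p), K * A:]"
    have "\<forall>\<^sub>F v in cofinite. poly P v = 0"
      using minors
    proof eventually_elim
      case (elim v)
      then have v: "v + s \<noteq> 0" "m v + s \<noteq> 0" by simp_all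
      define x y where "x = m v" and "y = m (m v)"
      have x: "x * (v + s) = p * v + q" and y: "y * (x + s) = p * x + q"
        using v by (simp add: x_def m[of v], simp add: x_def y_def m[of "m v"])
      have "(- C * p\<^sup>2 + p * ((A * x - B * y) + (A * y - B * x)) + (- C * x * y + K)) * (A * v - B * x)
        = (- C * p * q + (A * x - B * y) * p * s + (A * y - B * x) * q + (- C * x * y + K) * s) * (- C)"
        using elim E unfolding Let_def x_def y_def by simp
      moreover have "A = B + C"
        using E by (simp add: algebra_simps)
      \<comment> \<open>For \<open>K = 0\<close> the equation would be a cross-ratio equation,
        compatible with every Moebius map, so the \<open>K\<close>-free part of the minor cancels
        identically. Only the part linear in \<open>K\<close> remains.\<close>
      ultimately have "K * (A * v - B * x + C * s) = 0"
        using x y by algebra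
      then have "K * (A * v * (v + s) - B * (x * (v + s)) + C * s * (v + s)) = 0"
        by algebra
      then show ?case
        unfolding x P_def by (simp add: algebra_simps)
    qed
    then have "P = 0"
      by (rule poly_eq_0_if_cofinite)
    with A show ?thesis
      by (simp add: P_def)
  qed

  show "K = 0" if z: "p = 0" "s = 0" "L = 0"
  proof -
    define P where "P = [:- (K * B * q), 0, K * A:]"
    have "\<forall>\<^sub>F v in cofinite. poly P v = 0"
      using minors
    proof eventually_elim
      case (elim v)
      then have v: "v \<noteq> 0" "m v \<noteq> 0" by (simp_all add: z)
      have y: "m (m v) = v"
        using v by (simp add: m z)
      have x: "m v * v = q"
        using v by (simp add: m z)
      \<comment> \<open>Since \<open>m\<close> is the involution \<open>q / v\<close>, both sides of
        the first minor contain the factor \<open>A * v - B * m v\<close>, and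
        \<open>m v * v = q\<close> cancels the terms with \<open>C\<close>.\<close>
      have "(- C * m v * v + K) * (A * v - B * m v) = q * (A * v - B * m v) * (- C)"
        using elim unfolding Let_def y by (simp add: z algebra_simps)
      then have "K * (A * v - B * m v) = 0"
        using x by algebra
      then have "K * (A * v * v - B * (m v * v)) = 0"
        by algebra
      then show ?case
        unfolding x P_def by (simp add: algebra_simps)
    qed
    then have "P = 0"
      by (rule poly_eq_0_if_cofinite)
    with A show ?thesis
      by (simp add: P_def)
  qed
qed

end

section \<open>From admissibility to the constraints\<close>

text \<open>The multiplicative factor has no zeros on the domain, so every zero of the reduced
  equation is a zero of the shifted one. Replacing \<open>m w\<close> by a free variable
  \<open>z\<close> then gives the hypotheses of the affine case or of the locale.\<close>

lemma reduction_of_admissible: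
  fixes a1 a2 a3 a4 :: complex
  assumes adm: "admissible Q (moebius a1 a2 a3 a4) (moebius_dom a3 a4)"
    and Q: "\<And>u u1 u2 u12. eval4 Q u u1 u2 u12 = quad A B C L K u u1 u2 u12"
    and nz: "A \<noteq> 0" "B \<noteq> 0" "C \<noteq> 0" and det: "a1 * a4 - a2 * a3 \<noteq> 0"
  shows "a3 = 0 \<Longrightarrow> (A - B - C) * (a2 / a4) = (a1 / a4 - 1) * L \<and>
      2 * (a1 / a4 + 1) * L * (a2 / a4) = ((a1 / a4)\<^sup>2 - 1) * K"
    and "a3 \<noteq> 0 \<Longrightarrow>
      fractional_reduction A B C L K (a1 / a3) (a2 / a3) (a4 / a3) (moebius a1 a2 a3 a4)"
proof -
  let ?m = "moebius a1 a2 a3 a4" and ?D = "moebius_dom a3 a4"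
  have imp: "quad A B C L K (?m u) (?m v) (?m (?m v)) (?m (?m w)) = 0"
    if "quad A B C L K u v (?m v) (?m w) = 0"
      "u \<in> ?D" "v \<in> ?D" "w \<in> ?D" "?m v \<in> ?D" "?m w \<in> ?D" for u v w
    using adm that unfolding admissible_def Q by (metis divide_eq_0_iff mult_eq_0_iff)
  {
    assume "a3 = 0"
    define p q where "p = a1 / a4" and "q = a2 / a4"
    have "a4 \<noteq> 0" "a1 \<noteq> 0"
      using det \<open>a3 = 0\<close> by auto
    then have m: "?m u = p * u + q" for u
      by (simp add: moebius_def p_def q_def \<open>a3 = 0\<close> add_divide_distrib)
    have D: "?D = UNIV"
      using \<open>a3 = 0\<close> \<open>a4 \<noteq> 0\<close> by (simp add: moebius_dom_def)
    have "p \<noteq> 0"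
      using \<open>a1 \<noteq> 0\<close> \<open>a4 \<noteq> 0\<close> by (simp add: p_def)
    have "quad A B C L K (p * u + q) (p * v + q) (p * (p * v + q) + q) (p * z + q) = 0"
      if "quad A B C L K u v (p * v + q) z = 0" for u v z
      using imp[of u v "(z - q) / p"] that \<open>p \<noteq> 0\<close> by (simp add: m D)
    from affine_reduction[OF \<open>C \<noteq> 0\<close> \<open>p \<noteq> 0\<close> this]
    show "(A - B - C) * (a2 / a4) = (a1 / a4 - 1) * L \<and>
        2 * (a1 / a4 + 1) * L * (a2 / a4) = ((a1 / a4)\<^sup>2 - 1) * K"
      unfolding p_def q_def by blast
  }
  {
    assume "a3 \<noteq> 0"
    define p q s where "p = a1 / a3" and "q = a2 / a3" and "s = a4 / a3"
    have m: "?m u = (p * u + q) / (u + s)" for u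
    proof -
      have "a1 * u + a2 = a3 * (p * u + q)" "a3 * u + a4 = a3 * (u + s)"
        using \<open>a3 \<noteq> 0\<close> by (simp_all add: p_def q_def s_def distrib_left)
      then show ?thesis
        using \<open>a3 \<noteq> 0\<close> by (simp add: moebius_def)
    qed
    have D: "u \<in> ?D \<longleftrightarrow> u \<noteq> - s" for u
      using \<open>a3 \<noteq> 0\<close> by (auto simp: moebius_dom_def s_def field_simps add_eq_0_iff)
    have ps: "p * s - q \<noteq> 0"
      using det \<open>a3 \<noteq> 0\<close> by (simp add: p_def q_def s_def field_simps)
    have surj: "\<exists>w. w \<noteq> - s \<and> ?m w = z" if "z \<noteq> p" for z
    proof -
      \<comment> \<open>The solution of \<open>p * w + q = z * (w + s)\<close>.\<close>
      define w where "w = (q - s * z) / (z - p)"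
      have "w + s = - (p * s - q) / (z - p)" "p * w + q = - (p * s - q) * z / (z - p)"
        using that by (simp_all add: w_def field_simps)
      then have "?m w = z" "w \<noteq> - s"
        using ps that by (auto simp: m eq_neg_iff_add_eq_0)
      then show ?thesis
        by blast
    qed
    have imp': "quad A B C L K (?m u) (?m v) (?m (?m v)) (?m z) = 0"
      if "u \<noteq> - s" "v \<noteq> - s" "?m v \<noteq> - s" "z \<noteq> - s" "z \<noteq> p"
        "quad A B C L K u v (?m v) z = 0" for u v z
      using surj[OF \<open>z \<noteq> p\<close>] that imp unfolding D by metis
    show "fractional_reduction A B C L K (a1 / a3) (a2 / a3) (a4 / a3) ?m"
      unfolding p_def[symmetric] q_def[symmetric] s_def[symmetric]
      by unfold_locales (rule nz ps m imp'; assumption)+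
  }
qed

section \<open>Irreducibility forces nonzero coefficients\<close>

lemma eval4_mult: "eval4 (P * R) u u1 u2 u12 = eval4 P u u1 u2 u12 * eval4 R u u1 u2 u12"
  by (simp add: eval4_def eval3_def)

text \<open>Evaluation is multiplicative and sends 1 to 1, so a unit has no zeros. A factor with a
  zero is therefore not a unit.\<close>

lemma not_irreducible_mult:
  assumes "eval4 P u u1 u2 u12 = 0" and "eval4 R v v1 v2 v12 = 0"
  shows "\<not> irreducible (P * R)"
proof
  assume "irreducible (P * R)"
  then have "P dvd 1 \<or> R dvd 1"
    by (rule irreducibleD) simp
  moreover have "eval4 S w w1 w2 w12 \<noteq> 0" if "S dvd 1" for S :: quad_poly and w w1 w2 w12
  proof -
    from that obtain T where "S * T = 1"
      by (auto simp: dvd_def)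
    then have "eval4 S w w1 w2 w12 * eval4 T w w1 w2 w12 = 1"
      by (metis eval4_mult eval4_def eval3_def poly_1)
    then show ?thesis
      by auto
  qed
  ultimately show False
    using assms by blast
qed

text \<open>The polynomial counterpart of \<open>quad\<close> with \<open>L = K = 0\<close>.\<close>

definition quad_form :: "complex \<Rightarrow> complex \<Rightarrow> complex \<Rightarrow> quad_poly" where
  "quad_form A B C =
     const4 A * (U * U1 + U2 * U12) - const4 B * (U * U2 + U1 * U12) - const4 C * (U1 * U2 + U * U12)"

lemma const4_hom:
  "const4 0 = 0" "const4 1 = 1" "const4 (a + b) = const4 a + const4 b"
  "const4 (a - b) = const4 a - const4 b" "const4 (a * b) = const4 a * const4 b"
  "const4 (- a) = - const4 a"
  by (simp_all add: const4_def one_pCons)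

text \<open>When one coefficient vanishes and the other two agree up to sign, the form splits into
  two linear factors and a constant. The sign \<epsilon> is kept general for \<open>Q3\<close>,
  where it is a value of \<open>cosh\<close> at a zero of \<open>sinh\<close>.\<close>

lemma not_irreducible_quad_form:
  assumes "\<epsilon>\<^sup>2 = 1"
    and "A = 0 \<and> C = - (\<epsilon> * B) \<or> B = 0 \<and> C = \<epsilon> * A \<or> C = 0 \<and> A = \<epsilon> * B"
  shows "\<not> irreducible (quad_form A B C)"
proof -
  have e: "const4 \<epsilon> * const4 \<epsilon> = 1"
    using assms(1) by (metis const4_hom(2,5) power2_eq_square)
  \<comment> \<open>Both factors vanish at the origin.\<close>
  have red: "\<not> irreducible (const4 c * (S - const4 \<epsilon> * S') * (T - const4 \<epsilon> * T'))"
    if "{S, S', T, T'} \<subseteq> {U, U1, U2, U12}" for c S S' T T'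
    by (rule not_irreducible_mult[of _ 0 0 0 0 _ 0 0 0 0])
      (use that in \<open>auto simp: eval4_def eval3_def U_def U1_def U2_def U12_def const4_def\<close>)
  from assms(2) consider "A = 0" "C = - (\<epsilon> * B)" | "B = 0" "C = \<epsilon> * A" | "C = 0" "A = \<epsilon> * B"
    by blast
  then show ?thesis
  proof cases
    case 1
    have "quad_form A B C = const4 (- B) * (U - const4 \<epsilon> * U1) * (U2 - const4 \<epsilon> * U12)"
      unfolding quad_form_def 1 const4_hom using e by algebra
    then show ?thesis
      using red by simp
  next
    case 2
    have "quad_form A B C = const4 A * (U - const4 \<epsilon> * U2) * (U1 - const4 \<epsilon> * U12)"
      unfolding quad_form_def 2 const4_hom using e by algebra
    then show ?thesis
      using red by simp
  next
    case 3
    have "quad_form A B C = const4 (\<epsilon> * B) * (U - const4 \<epsilon> * U12) * (U1 - const4 \<epsilon> * U2)"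
      unfolding quad_form_def 3 const4_hom using e by algebra
    then show ?thesis
      using red by simp
  qed
qed

text \<open>The constant term contains the product of the three coefficients, so it disappears
  together with any one of them and leaves a reducible \<open>quad_form\<close>.\<close>

lemma Q1_irreducible_nz:
  assumes "irreducible (Q1 \<alpha> \<beta> \<delta>)"
  shows "\<alpha> \<noteq> 0" "\<beta> \<noteq> 0" "\<alpha> - \<beta> \<noteq> 0"
proof -
  have Q: "Q1 \<alpha> \<beta> \<delta> = quad_form \<alpha> \<beta> (\<alpha> - \<beta>) + const4 (\<delta>\<^sup>2 * \<alpha> * \<beta> * (\<alpha> - \<beta>))"
    unfolding Q1_def quad_form_def const4_hom by algebra
  have "\<not> irreducible (quad_form \<alpha> \<beta> (\<alpha> - \<beta>))" if "\<alpha> * \<beta> * (\<alpha> - \<beta>) = 0"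
    by (rule not_irreducible_quad_form[of 1]) (use that in auto)
  moreover have "Q1 \<alpha> \<beta> \<delta> = quad_form \<alpha> \<beta> (\<alpha> - \<beta>)" if "\<alpha> * \<beta> * (\<alpha> - \<beta>) = 0"
    using that unfolding Q by (auto simp: const4_hom(1))
  ultimately have "\<alpha> * \<beta> * (\<alpha> - \<beta>) \<noteq> 0"
    using assms by metis
  then show "\<alpha> \<noteq> 0" "\<beta> \<noteq> 0" "\<alpha> - \<beta> \<noteq> 0"
    by auto
qed

lemma Q2_irreducible_nz:
  assumes "irreducible (Q2 \<alpha> \<beta>)"
  shows "\<alpha> \<noteq> 0" "\<beta> \<noteq> 0" "\<alpha> - \<beta> \<noteq> 0"
proof -
  have Q: "Q2 \<alpha> \<beta> = quad_form \<alpha> \<beta> (\<alpha> - \<beta>)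
      + const4 (\<alpha> * \<beta> * (\<alpha> - \<beta>)) * (U + U2 + U1 + U12 - const4 (\<alpha>^2 + \<beta>^2 - \<alpha> * \<beta>))"
    unfolding Q2_def quad_form_def const4_hom by algebra
  have "\<not> irreducible (quad_form \<alpha> \<beta> (\<alpha> - \<beta>))" if "\<alpha> * \<beta> * (\<alpha> - \<beta>) = 0"
    by (rule not_irreducible_quad_form[of 1]) (use that in auto)
  moreover have "Q2 \<alpha> \<beta> = quad_form \<alpha> \<beta> (\<alpha> - \<beta>)" if "\<alpha> * \<beta> * (\<alpha> - \<beta>) = 0"
    unfolding Q that by (simp add: const4_hom(1))
  ultimately have "\<alpha> * \<beta> * (\<alpha> - \<beta>) \<noteq> 0"
    using assms by metis
  then show "\<alpha> \<noteq> 0" "\<beta> \<noteq> 0" "\<alpha> - \<beta> \<noteq> 0"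
    by auto
qed

text \<open>Where \<open>sinh\<close> vanishes, \<open>cosh\<close> squares to 1, and the addition
  formulas show that the two remaining coefficients differ by just this sign.\<close>

lemma Q3_irreducible_nz:
  assumes "irreducible (Q3 \<alpha> \<beta> \<delta>)"
  shows "sinh \<alpha> \<noteq> 0" "sinh \<beta> \<noteq> 0" "sinh (\<alpha> - \<beta>) \<noteq> 0"
proof -
  let ?P = "sinh \<alpha> * sinh \<beta> * sinh (\<alpha> - \<beta>)"
  have Q: "Q3 \<alpha> \<beta> \<delta> = quad_form (sinh \<alpha>) (sinh \<beta>) (sinh (\<alpha> - \<beta>)) + const4 (\<delta>\<^sup>2 * ?P)"
    unfolding Q3_def quad_form_def const4_hom by algebra
  have diff: "sinh (\<alpha> - \<beta>) = sinh \<alpha> * cosh \<beta> - cosh \<alpha> * sinh \<beta>"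
    by (rule sinh_diff)
  have sum: "sinh \<alpha> = sinh (\<alpha> - \<beta>) * cosh \<beta> + cosh (\<alpha> - \<beta>) * sinh \<beta>"
    using sinh_add[of "\<alpha> - \<beta>" \<beta>] by simp
  have cosh1: "(cosh x)\<^sup>2 = 1" if "sinh x = 0" for x :: complex
    using that by (simp add: cosh_square_eq)
  have "\<not> irreducible (quad_form (sinh \<alpha>) (sinh \<beta>) (sinh (\<alpha> - \<beta>)))" if "?P = 0"
  proof -
    from that consider "sinh \<alpha> = 0" | "sinh \<beta> = 0" | "sinh (\<alpha> - \<beta>) = 0"
      by auto
    then show ?thesis
    proof cases
      case 1
      then show ?thesis
        using not_irreducible_quad_form[OF cosh1[OF 1]] diff by simp
    next
      case 2
      then show ?thesis
        using not_irreducible_quad_form[OF cosh1[OF 2]] diff by (simp add: mult.commute)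
    next
      case 3
      then show ?thesis
        using not_irreducible_quad_form[OF cosh1[OF 3]] sum by simp
    qed
  qed
  moreover have "Q3 \<alpha> \<beta> \<delta> = quad_form (sinh \<alpha>) (sinh \<beta>) (sinh (\<alpha> - \<beta>))" if "?P = 0"
    unfolding Q that by (simp add: const4_hom(1))
  ultimately have "?P \<noteq> 0"
    using assms by metis
  then show "sinh \<alpha> \<noteq> 0" "sinh \<beta> \<noteq> 0" "sinh (\<alpha> - \<beta>) \<noteq> 0"
    by auto
qed

text \<open>Squaring the supposed equality and comparing with the expansion of
  \<open>(sinh (\<alpha> - \<beta>))\<^sup>2\<close> gives
  \<open>cosh (\<alpha> - \<beta>) = 1\<close>, hence \<open>sinh (\<alpha> - \<beta>) = 0\<close>.
  For \<open>Q3\<close> this rules out translations and a nonzero value of \<open>m\<close> at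
  infinity.\<close>

lemma sinh_diff_neq:
  fixes \<alpha> \<beta> :: complex
  assumes "sinh \<alpha> \<noteq> 0" "sinh \<beta> \<noteq> 0" "sinh (\<alpha> - \<beta>) \<noteq> 0"
  shows "sinh \<alpha> - sinh \<beta> - sinh (\<alpha> - \<beta>) \<noteq> 0"
proof
  assume "sinh \<alpha> - sinh \<beta> - sinh (\<alpha> - \<beta>) = 0"
  then have "(sinh \<alpha> - sinh \<beta>)\<^sup>2 = (sinh (\<alpha> - \<beta>))\<^sup>2"
    by simp
  moreover have "(sinh (\<alpha> - \<beta>))\<^sup>2 =
      (sinh \<alpha>)\<^sup>2 + (sinh \<beta>)\<^sup>2 - 2 * sinh \<alpha> * sinh \<beta> * cosh (\<alpha> - \<beta>)"
    unfolding sinh_diff cosh_diff using hyperbolic_pythagoras[of \<alpha>] hyperbolic_pythagoras[of \<beta>]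
    by algebra
  ultimately have "2 * sinh \<alpha> * sinh \<beta> * (cosh (\<alpha> - \<beta>) - 1) = 0"
    by algebra
  with assms(1,2) have "cosh (\<alpha> - \<beta>) = 1"
    by simp
  with assms(3) hyperbolic_pythagoras[of "\<alpha> - \<beta>"] show False
    by simp
qed

section \<open>Admissibility of the listed reductions\<close>

lemma admissible_if_invariant:
  assumes "\<And>u v w. \<lbrakk>u \<in> D; v \<in> D; w \<in> D; m v \<in> D; m w \<in> D\<rbrakk> \<Longrightarrow>
    eval4 Q u v (m v) (m w) = eval4 Q (m u) (m v) (m (m v)) (m (m w))"
  shows "admissible Q m D"
  unfolding admissible_def
  by (rule exI[of _ 1], rule exI[of _ 1]) (use assms in \<open>auto simp: eval3_def\<close>)

lemma moebius_dom_infinite: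
  assumes "a1 * a4 - a2 * a3 \<noteq> 0"
  shows "infinite (moebius_dom a3 a4)"
proof -
  have "[:a4, a3:] \<noteq> 0"
    using assms by auto
  from eventually_cofinite_poly_neq_0[OF this]
  have "finite (- moebius_dom a3 a4)"
    by (simp add: eventually_cofinite moebius_dom_def Compl_eq add.commute mult.commute)
  then show ?thesis
    using infinite_UNIV_char_0[where 'a = complex] by (metis Compl_partition finite_Un)
qed

text \<open>Used to read off the coefficients of \<open>m\<close> from a formula known only on its
  domain.\<close>

lemma poly_eq_0_on_moebius_dom:
  assumes "a1 * a4 - a2 * a3 \<noteq> 0" and "\<And>u. u \<in> moebius_dom a3 a4 \<Longrightarrow> poly P u = 0"
  shows "P = 0"
  using moebius_dom_infinite[OF assms(1)] assms(2) poly_roots_finite[of P]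
  by (metis (mono_tags, lifting) finite_subset mem_Collect_eq subsetI)

text \<open>This is the cross-ratio equation: each term is a product of two differences containing
  every argument once. A Moebius map multiplies \<open>x - y\<close> by
  \<open>\<Delta> / (h x * h y)\<close>, so both terms acquire the same factor.\<close>

lemma admissible_Q1_0:
  assumes "a1 * a4 - a2 * a3 \<noteq> 0"
  shows "admissible (Q1 \<alpha> \<beta> 0) (moebius a1 a2 a3 a4) (moebius_dom a3 a4)"
proof -
  let ?m = "moebius a1 a2 a3 a4" and ?D = "moebius_dom a3 a4"
  define \<Delta> where "\<Delta> = a1 * a4 - a2 * a3"
  define h where "h x = a3 * x + a4" for x
  \<comment> \<open>The factor is \<open>h u * h v * h (m v) * h (m w) / \<Delta>\<^sup>2\<close>.
    Here \<open>h (m v) * h v\<close> and \<open>h (m w) * h w\<close> are polynomials; the extra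
    \<open>h w\<close> in the numerator is compensated in \<open>q\<close>.\<close>
  define p :: "complex poly poly poly" where
    "p = [:[:[:a4, a3:]:]:] * [:[:[:a3 * a2 + a4 * a4:], [:a3 * a1 + a4 * a3:]:]:]
      * [:[:[:a3 * a2 + a4 * a4:]:], [:[:a3 * a1 + a4 * a3:]:]:]"
  define q :: "complex poly poly poly" where
    "q = [:[:[:\<Delta>\<^sup>2:]:]:] * [:[:[:a4:]:], [:[:a3:]:]:]"
  show ?thesis
    unfolding admissible_def
  proof (rule exI[of _ p], rule exI[of _ q], intro allI impI, elim conjE)
    fix u v w
    assume "u \<in> ?D" "v \<in> ?D" "w \<in> ?D" "?m v \<in> ?D" "?m w \<in> ?D"
    then have nz: "h u \<noteq> 0" "h v \<noteq> 0" "h w \<noteq> 0" "h (?m v) \<noteq> 0" "h (?m w) \<noteq> 0"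
      by (simp_all add: moebius_dom_def h_def)
    have hm: "h (?m x) * h x = (a3 * a2 + a4 * a4) + (a3 * a1 + a4 * a3) * x" if "h x \<noteq> 0" for x
    proof -
      have "?m x * h x = a1 * x + a2"
        using that by (simp add: moebius_def h_def)
      then show ?thesis
        unfolding h_def by algebra
    qed
    have p: "eval3 p u v w = h u * (h (?m v) * h v) * (h (?m w) * h w)"
      unfolding hm[OF nz(2)] hm[OF nz(3)] by (simp add: p_def eval3_def h_def algebra_simps)
    have q: "eval3 q u v w = \<Delta>\<^sup>2 * h w"
      by (simp add: q_def eval3_def h_def algebra_simps)
    have diff: "(?m x - ?m y) * (h x * h y) = \<Delta> * (x - y)" if "h x \<noteq> 0" "h y \<noteq> 0" for x y
    proof -
      have "?m x * h x = a1 * x + a2" "?m y * h y = a1 * y + a2"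
        using that by (simp_all add: moebius_def h_def)
      then show ?thesis
        unfolding h_def \<Delta>_def by algebra
    qed
    have "\<Delta> \<noteq> 0"
      using assms by (simp add: \<Delta>_def)
    define x y where "x = ?m v" and "y = ?m w"
    have Q: "eval4 (Q1 \<alpha> \<beta> 0) a b c d = \<alpha> * (a - c) * (b - d) - \<beta> * (a - b) * (c - d)" for a b c d
      by (simp add: eval4_Q1)
    have "eval4 (Q1 \<alpha> \<beta> 0) (?m u) (?m v) (?m x) (?m y) * (h u * h v * h x * h y)
      = \<alpha> * ((?m u - ?m x) * (h u * h x)) * ((?m v - ?m y) * (h v * h y))
        - \<beta> * ((?m u - ?m v) * (h u * h v)) * ((?m x - ?m y) * (h x * h y))"
      unfolding Q by algebra
    also have "\<dots> = \<Delta>\<^sup>2 * eval4 (Q1 \<alpha> \<beta> 0) u v x y"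
      using nz unfolding Q x_def y_def by (simp add: diff) algebra
    finally have "eval4 (Q1 \<alpha> \<beta> 0) u v x y =
        (h u * h v * h x * h y) / \<Delta>\<^sup>2 * eval4 (Q1 \<alpha> \<beta> 0) (?m u) (?m v) (?m x) (?m y)"
      using \<open>\<Delta> \<noteq> 0\<close> by (simp add: field_simps)
    also have "(h u * h v * h x * h y) / \<Delta>\<^sup>2 = eval3 p u v w / eval3 q u v w"
      unfolding p q x_def y_def using nz \<open>\<Delta> \<noteq> 0\<close> by (simp add: field_simps)
    finally show "eval3 p u v w \<noteq> 0 \<and> eval3 q u v w \<noteq> 0 \<and>
        eval4 (Q1 \<alpha> \<beta> 0) u v (?m v) (?m w) =
          eval3 p u v w / eval3 q u v w
          * eval4 (Q1 \<alpha> \<beta> 0) (?m u) (?m v) (?m (?m v)) (?m (?m w))"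
      unfolding x_def y_def using nz \<open>\<Delta> \<noteq> 0\<close> by (simp add: p q)
  qed
qed

text \<open>On these points \<open>m\<close> is an involution, and the multiplicative factor is
  \<open>u / w\<close>.\<close>

lemma admissible_Q3_0_inverse:
  assumes "\<And>u. u \<in> D \<Longrightarrow> m u = a / u" and "0 \<notin> D" and "a \<noteq> 0"
  shows "admissible (Q3 \<alpha> \<beta> 0) m D"
  unfolding admissible_def
proof (rule exI[of _ "[:[:[:0, 1:]:]:]"], rule exI[of _ "[:0, 1:]"], intro allI impI, elim conjE)
  fix u v w
  assume D: "u \<in> D" "v \<in> D" "w \<in> D" "m v \<in> D" "m w \<in> D"
  then have "u \<noteq> 0" "v \<noteq> 0" "w \<noteq> 0"
    using \<open>0 \<notin> D\<close> by auto
  have "m (m v) = v" "m (m w) = w"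
    using D assms(1)[of "m v"] assms(1)[of "m w"] assms(1)[of v] assms(1)[of w] \<open>a \<noteq> 0\<close> by simp_all
  then show "eval3 [:[:[:0, 1:]:]:] u v w \<noteq> 0 \<and> eval3 [:0, 1:] u v w \<noteq> 0 \<and>
      eval4 (Q3 \<alpha> \<beta> 0) u v (m v) (m w) =
        eval3 [:[:[:0, 1:]:]:] u v w / eval3 [:0, 1:] u v w *
        eval4 (Q3 \<alpha> \<beta> 0) (m u) (m v) (m (m v)) (m (m w))"
    using D assms(1) \<open>u \<noteq> 0\<close> \<open>v \<noteq> 0\<close> \<open>w \<noteq> 0\<close>
    by (simp add: eval3_def eval4_Q3 field_simps)
qed

text \<open>For \<delta> = 0 the polynomial is homogeneous of degree two, so the factor is
  \<open>1 / c\<^sup>2\<close>.\<close>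

lemma admissible_Q3_0_scale:
  assumes "\<And>u. u \<in> D \<Longrightarrow> m u = c * u" and "c \<noteq> 0"
  shows "admissible (Q3 \<alpha> \<beta> 0) m D"
  unfolding admissible_def
  by (rule exI[of _ 1], rule exI[of _ "[:[:[:c\<^sup>2:]:]:]"])
    (use assms in \<open>auto simp: eval3_def eval4_Q3 field_simps power2_eq_square\<close>)

section \<open>The three classifications\<close>

text \<open>With \<open>L = 0\<close> and \<open>A = B + C\<close>, the affine constraints reduce to
  \<open>(p\<^sup>2 - 1) * K = 0\<close>, and a pole forces \<open>K = 0\<close>, that is, \<delta>
  = 0.\<close>

lemma admissible_Q1_iff:
  assumes det: "a1 * a4 - a2 * a3 \<noteq> 0" and irr: "irreducible (Q1 \<alpha> \<beta> \<delta>)"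
  defines "m \<equiv> moebius a1 a2 a3 a4" and "D \<equiv> moebius_dom a3 a4"
  shows "admissible (Q1 \<alpha> \<beta> \<delta>) m D \<longleftrightarrow>
    (\<exists>a. \<forall>u\<in>D. m u = a + u) \<or> (\<exists>a. \<forall>u\<in>D. m u = a - u) \<or> \<delta> = 0"
    (is "?L \<longleftrightarrow> ?R")
proof
  assume ?L
  note nz = Q1_irreducible_nz[OF irr]
  define K where "K = \<delta>\<^sup>2 * \<alpha> * \<beta> * (\<alpha> - \<beta>)"
  have K0: "K = 0 \<longleftrightarrow> \<delta> = 0"
    using nz by (simp add: K_def)
  have "eval4 (Q1 \<alpha> \<beta> \<delta>) u u1 u2 u12 = quad \<alpha> \<beta> (\<alpha> - \<beta>) 0 K u u1 u2 u12" for u u1 u2 u12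
    unfolding eval4_Q1 quad_def K_def by algebra
  note red = reduction_of_admissible[OF \<open>?L\<close>[unfolded m_def D_def] this nz det]
  show ?R
  proof (cases "a3 = 0")
    case True
    then have "a4 \<noteq> 0"
      using det by auto
    from red(1)[OF True] have "a1 / a4 = 1 \<or> a1 / a4 = -1 \<or> \<delta> = 0"
      using K0 by (auto simp: power2_eq_1_iff)
    with \<open>a4 \<noteq> 0\<close> have "a1 = a4 \<or> a1 = - a4 \<or> \<delta> = 0"
      by (auto simp: field_simps)
    then show ?thesis
    proof (elim disjE)
      assume "a1 = a4"
      then have "\<forall>u\<in>D. m u = a2 / a4 + u"
        using True \<open>a4 \<noteq> 0\<close> by (simp add: m_def moebius_def field_simps)
      then show ?thesis by blast
    next
      assume "a1 = - a4"
      then have "\<forall>u\<in>D. m u = a2 / a4 - u"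
        using True \<open>a4 \<noteq> 0\<close> by (simp add: m_def moebius_def field_simps)
      then show ?thesis by blast
    qed simp
  next
    case False
    interpret fractional_reduction \<alpha> \<beta> "\<alpha> - \<beta>" 0 K "a1 / a3" "a2 / a3" "a4 / a3" "moebius a1 a2 a3 a4"
      by (rule red(2)[OF False])
    show ?thesis
      using constraints(3) K0 by simp
  qed
next
  assume ?R
  then consider a where "\<forall>u\<in>D. m u = a + u" | a where "\<forall>u\<in>D. m u = a - u" | "\<delta> = 0"
    by blast
  then show ?L
  proof cases
    case 3
    then show ?thesis
      unfolding m_def D_def using admissible_Q1_0[OF det] by simp
  next
    case 2
    show ?thesis
    proof (rule admissible_if_invariant)
      fix u v w
      assume "u \<in> D" "v \<in> D" "w \<in> D" "m v \<in> D" "m w \<in> D"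
      with 2 have "m u = a - u" "m v = a - v" "m (m v) = a - m v" "m (m w) = a - m w"
        by blast+
      then show "eval4 (Q1 \<alpha> \<beta> \<delta>) u v (m v) (m w) = eval4 (Q1 \<alpha> \<beta> \<delta>) (m u) (m v) (m (m v)) (m (m w))"
        unfolding eval4_Q1 by algebra
    qed
  qed (rule admissible_if_invariant; simp add: eval4_Q1 algebra_simps)
qed

text \<open>With \<open>A = B + C\<close> and \<open>L\<close> nonzero, the affine constraints give
  slope 1 and then shift 0, while a pole would force \<open>L = 0\<close>.\<close>

lemma admissible_Q2_iff:
  assumes det: "a1 * a4 - a2 * a3 \<noteq> 0" and irr: "irreducible (Q2 \<alpha> \<beta>)"
  defines "m \<equiv> moebius a1 a2 a3 a4" and "D \<equiv> moebius_dom a3 a4"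
  shows "admissible (Q2 \<alpha> \<beta>) m D \<longleftrightarrow> (\<forall>u\<in>D. m u = u)"
    (is "?L \<longleftrightarrow> ?R")
proof
  assume ?L
  note nz = Q2_irreducible_nz[OF irr]
  define L where "L = \<alpha> * \<beta> * (\<alpha> - \<beta>)"
  define K where "K = - L * (\<alpha>\<^sup>2 + \<beta>\<^sup>2 - \<alpha> * \<beta>)"
  have "L \<noteq> 0"
    using nz by (simp add: L_def)
  have "eval4 (Q2 \<alpha> \<beta>) u u1 u2 u12 = quad \<alpha> \<beta> (\<alpha> - \<beta>) L K u u1 u2 u12" for u u1 u2 u12
    unfolding eval4_Q2 quad_def K_def L_def by algebra
  note red = reduction_of_admissible[OF \<open>?L\<close>[unfolded m_def D_def] this nz det]
  show ?R
  proof (cases "a3 = 0")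
    case True
    then have "a4 \<noteq> 0"
      using det by auto
    from red(1)[OF True] \<open>L \<noteq> 0\<close> have "a1 / a4 = 1"
      by simp
    with red(1)[OF True] \<open>L \<noteq> 0\<close> \<open>a4 \<noteq> 0\<close> have "a1 = a4" "a2 = 0"
      by auto
    with True \<open>a4 \<noteq> 0\<close> show ?thesis
      by (simp add: m_def moebius_def)
  next
    case False
    interpret fractional_reduction \<alpha> \<beta> "\<alpha> - \<beta>" L K "a1 / a3" "a2 / a3" "a4 / a3" "moebius a1 a2 a3 a4"
      by (rule red(2)[OF False])
    show ?thesis
      using constraints(1) \<open>L \<noteq> 0\<close> by simp
  qed
next
  assume ?R
  then show ?L
    by (intro admissible_if_invariant) simp
qed

text \<open>Since \<open>A - B - C\<close> is nonzero and \<open>L = 0\<close>, an affine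
  \<open>m\<close> has shift 0 and satisfies \<open>(p\<^sup>2 - 1) * K = 0\<close>. For an
  \<open>m\<close> with a pole, \<open>p\<close>, \<open>s\<close> and \<open>K\<close> vanish in
  turn.\<close>

lemma admissible_Q3_iff:
  assumes det: "a1 * a4 - a2 * a3 \<noteq> 0" and irr: "irreducible (Q3 \<alpha> \<beta> \<delta>)"
  defines "m \<equiv> moebius a1 a2 a3 a4" and "D \<equiv> moebius_dom a3 a4"
  shows "admissible (Q3 \<alpha> \<beta> \<delta>) m D \<longleftrightarrow>
    (\<forall>u\<in>D. m u = u) \<or> (\<forall>u\<in>D. m u = - u) \<or>
    (\<delta> = 0 \<and> (\<exists>a. \<forall>u\<in>D. m u = a / u)) \<or>
    (\<delta> = 0 \<and> (\<exists>c. \<forall>u\<in>D. m u = c * u))"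
    (is "?L \<longleftrightarrow> ?R")
proof
  assume ?L
  note nz = Q3_irreducible_nz[OF irr]
  define K where "K = sinh (\<alpha> - \<beta>) * (\<delta>\<^sup>2 * sinh \<alpha> * sinh \<beta>)"
  have K0: "K = 0 \<longleftrightarrow> \<delta> = 0"
    using nz by (simp add: K_def)
  note E = sinh_diff_neq[OF nz]
  have "eval4 (Q3 \<alpha> \<beta> \<delta>) u u1 u2 u12 =
      quad (sinh \<alpha>) (sinh \<beta>) (sinh (\<alpha> - \<beta>)) 0 K u u1 u2 u12" for u u1 u2 u12
    unfolding eval4_Q3 quad_def K_def by algebra
  note red = reduction_of_admissible[OF \<open>?L\<close>[unfolded m_def D_def] this nz det]
  show ?R
  proof (cases "a3 = 0")
    case True
    then have "a4 \<noteq> 0"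
      using det by auto
    from red(1)[OF True] E \<open>a4 \<noteq> 0\<close> have "a2 = 0"
      by simp
    define c where "c = a1 / a4"
    have "c = 1 \<or> c = - 1 \<or> \<delta> = 0"
      using red(1)[OF True] K0 by (auto simp: power2_eq_1_iff c_def)
    moreover have "\<forall>u\<in>D. m u = c * u"
      using True \<open>a2 = 0\<close> by (simp add: m_def moebius_def c_def)
    ultimately show ?thesis
      by auto
  next
    case False
    interpret fractional_reduction "sinh \<alpha>" "sinh \<beta>" "sinh (\<alpha> - \<beta>)" 0 K
      "a1 / a3" "a2 / a3" "a4 / a3" "moebius a1 a2 a3 a4"
      by (rule red(2)[OF False])
    have p: "a1 / a3 = 0"
      using constraints(1) E by simp
    have s: "a4 / a3 = 0"
      using constraints(2)[OF p] E by simp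
    have "\<delta> = 0"
      using constraints(4)[OF p s] K0 by simp
    moreover have "\<forall>u\<in>D. m u = (a2 / a3) / u"
      using p s False by (simp add: m_def moebius_def)
    ultimately show ?thesis
      by blast
  qed
next
  assume ?R
  then consider "\<forall>u\<in>D. m u = u" | "\<forall>u\<in>D. m u = - u"
    | a where "\<delta> = 0" "\<forall>u\<in>D. m u = a / u" | c where "\<delta> = 0" "\<forall>u\<in>D. m u = c * u"
    by blast
  then show ?L
  proof cases
    case 3
    \<comment> \<open>Because \<open>a / 0 = 0\<close>, the origin must be treated separately: the
      cross-multiplied identity is first obtained for nonzero \<open>u\<close> and then multiplied
      by \<open>u\<close> to hold on all of \<open>D\<close>. It yields \<open>a1 = 0\<close> and,
      by nondegeneracy, nonzero \<open>a\<close> and \<open>a4 = 0\<close>, so the origin lies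
      outside \<open>D\<close>.\<close>
    have "poly [:- (a * a4), a2 - a * a3, a1:] u = 0" if "u \<in> D" "u \<noteq> 0" for u
    proof -
      have "a3 * u + a4 \<noteq> 0" "(a1 * u + a2) / (a3 * u + a4) = a / u"
        using that 3 by (auto simp: m_def D_def moebius_def moebius_dom_def)
      with \<open>u \<noteq> 0\<close> show ?thesis
        by (simp add: frac_eq_eq algebra_simps)
    qed
    then have "poly ([:0, 1:] * [:- (a * a4), a2 - a * a3, a1:]) u = 0" if "u \<in> D" for u
      using that by (cases "u = 0") (auto simp only: poly_mult poly_pCons, simp_all)
    from poly_eq_0_on_moebius_dom[OF det this[unfolded D_def]]
    have "a1 = 0" "a2 = a * a3" "a * a4 = 0"
      by simp_all
    then have "a \<noteq> 0" "0 \<notin> D"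
      using det by (auto simp: D_def moebius_dom_def)
    with 3 show ?thesis
      by (auto intro: admissible_Q3_0_inverse)
  next
    case 4
    have "c \<noteq> 0"
    proof
      assume "c = 0"
      then have "poly [:a2, a1:] u = 0" if "u \<in> D" for u
        using that 4 by (auto simp: m_def D_def moebius_def moebius_dom_def algebra_simps)
      from poly_eq_0_on_moebius_dom[OF det this[unfolded D_def]] det show False
        by simp
    qed
    with 4 show ?thesis
      by (auto intro: admissible_Q3_0_scale)
  qed (rule admissible_if_invariant; simp add: eval4_Q3)+
qed

theorem mainTheorem1:
  fixes \<alpha> \<beta> \<delta> a1 a2 a3 a4 :: complex
    and m :: "complex \<Rightarrow> complex" and D :: "complex set"
  assumes nondegenerate: "a1 * a4 - a2 * a3 \<noteq> 0"
    and m: "m = moebius a1 a2 a3 a4"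
    and D: "D = moebius_dom a3 a4"
  shows
    "(irreducible (Q1 \<alpha> \<beta> \<delta>) \<longrightarrow>
       (admissible (Q1 \<alpha> \<beta> \<delta>) m D \<longleftrightarrow>
          (\<exists>a. \<forall>u\<in>D. m u = a + u) \<or> (\<exists>a. \<forall>u\<in>D. m u = a - u) \<or>
          (\<delta> = 0 \<and> a2 * a3 - a1 * a4 \<noteq> 0))) \<and>
     (irreducible (Q2 \<alpha> \<beta>) \<longrightarrow>
       (admissible (Q2 \<alpha> \<beta>) m D \<longleftrightarrow> (\<forall>u\<in>D. m u = u))) \<and>
     (irreducible (Q3 \<alpha> \<beta> \<delta>) \<longrightarrow>
       (admissible (Q3 \<alpha> \<beta> \<delta>) m D \<longleftrightarrow>
          (\<forall>u\<in>D. m u = u) \<or> (\<forall>u\<in>D. m u = - u) \<or>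
          (\<delta> = 0 \<and> (\<exists>a. \<forall>u\<in>D. m u = a / u)) \<or>
          (\<delta> = 0 \<and> (\<exists>c. \<forall>u\<in>D. m u = c * u))))"
  using nondegenerate admissible_Q1_iff[OF nondegenerate] admissible_Q2_iff[OF nondegenerate]
    admissible_Q3_iff[OF nondegenerate]
  unfolding m D by (auto simp: mult.commute)

end
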